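(* There exists an infinite word $\mathbf{w}$ over a $3$-letter alphabet such that no arithmetic subsequence of odd difference of $\mathbf{w}$ contains a $2^+$-power (overlap), and no arithmetic subsequence of odd difference of $\mathbf{w}$ contains a square $xx$ with $|x| \geq 2$.
   Context: Infinite words $\mathbf{w} = w_0w_1w_2\cdots$ are indexed from $0$. An arithmetic subsequence of difference $j$ of $\mathbf{w}$ is a word $w_iw_{i+j}w_{i+2j}\cdots$ with $i \geq 0$, $j \geq 1$. "Contains" refers to contiguous blocks (subwords). A square is a word $xx$ with $x$ non-empty. For a positive rational $q$, a $q$-power is a non-empty word $x^kx'$, where $k\ge 0$ is an integer, $x'$ is a prefix of $x$ and $|x^kx'|/|x| = q$. A word contains a $2^+$-power (overlap) if it contains a $q$-power as a subword for some rational $q > 2$. *)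

theory Defs
  imports Complex_Main "HOL-Library.Sublist" "HOL-Library.Omega_Words_Fun"
begin

(* Sublist and Omega_Words_Fun both declare "prefix", hence the qualified names below. *)

definition arith_subsequence :: "nat \<Rightarrow> 'a word \<Rightarrow> 'a word \<Rightarrow> bool"
  where "arith_subsequence j v w \<longleftrightarrow> j \<ge> 1 \<and> (\<exists>i. v = (\<lambda>n. w (i + n * j)))"

definition contains_block :: "'a word \<Rightarrow> 'a list \<Rightarrow> bool"
  where "contains_block w u \<longleftrightarrow> (\<exists>m n. u = Omega_Words_Fun.subsequence w m n)"

(* x must be non-empty for the exponent to be meaningful, since division by 0 yields 0.
   No hypothesis q > 0 is needed: u non-empty already forces it. *)
definition rat_power :: "rat \<Rightarrow> 'a list \<Rightarrow> bool"
  where "rat_power q u \<longleftrightarrow> u \<noteq> [] \<and>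
    (\<exists>x k x'. x \<noteq> [] \<and> Sublist.prefix x' x \<and> u = concat (replicate k x) @ x' \<and>
       of_nat (length u) / of_nat (length x) = q)"

definition contains_overlap :: "'a word \<Rightarrow> bool"
  where "contains_overlap w \<longleftrightarrow> (\<exists>q u. q > 2 \<and> rat_power q u \<and> contains_block w u)"

end

theory Submission
  imports Defs "HOL-Number_Theory.Cong"
begin

text \<open>
  The word is a variant of the paperfolding word. Write a position as \<open>n = 2 ^ k * m\<close> with \<open>m\<close>
  odd and call \<open>k\<close> its level. The letter at \<open>n\<close> is decided by \<open>m mod 4\<close>, as in the paperfolding
  word, but the two letters in use depend on the level: \<open>a\<close>/\<open>b\<close> at level 0, \<open>b\<close>/\<open>c\<close> at level 1
  and \<open>a\<close>/\<open>c\<close> at all higher levels.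

  Along a progression of odd difference \<open>j\<close>, the residues modulo a power of 2 are visited
  cyclically, each once per round, exactly as for difference 1. So \<open>j\<close> hardly matters, and a
  square of period \<open>p\<close> is excluded by finding one position in it whose letter differs from the
  letter \<open>p\<close> steps away.

  If \<open>p = 2 ^ s * d\<close> with \<open>d\<close> odd and \<open>s \<ge> 1\<close>, the first half of the square meets level \<open>s - 1\<close>.
  A shift by \<open>p * j\<close> keeps that level but changes the odd part by 2 modulo 4, so the letter changes
  (\<open>no_square_of_even_period\<close>).

  If \<open>p\<close> is odd, the shift exchanges odd positions, which carry only \<open>a\<close> and \<open>b\<close>, with even ones.
  Then \<open>c\<close> cannot occur anywhere in the square; but for \<open>p \<ge> 5\<close> the square is long enough to meet a
  level 1 position carrying \<open>c\<close> (\<open>no_square_of_large_odd_period\<close>). For \<open>p = 3\<close>, and for the cubes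
  of a single letter to which overlaps of period 1 reduce, one uses
  that any two of the three pairs share just one letter, which the third pair lacks
  (\<open>no_square_of_period_three\<close>, \<open>no_cube_of_letter\<close>).
\<close>

section \<open>The levelled paperfolding word\<close>

text \<open>The value at \<open>0\<close>, which has no odd part, is \<open>False\<close>; only the membership of the resulting
  letter in the pair for high levels matters there.\<close>

fun turn :: "nat \<Rightarrow> bool"
  where "turn n = (if even n \<and> n \<noteq> 0 then turn (n div 2) else n mod 4 = 1)"

declare turn.simps [simp del]

lemma turn_odd: "odd n \<Longrightarrow> turn n \<longleftrightarrow> n mod 4 = 1"
  by (subst turn.simps) simp

lemma turn_double: "n > 0 \<Longrightarrow> turn (2 * n) = turn n"
  by (subst turn.simps) simp

lemma turn_power_mult: "odd m \<Longrightarrow> turn (2 ^ k * m) \<longleftrightarrow> m mod 4 = 1"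
proof (induction k)
  case 0
  then show ?case by (simp add: turn_odd)
next
  case (Suc k)
  moreover have "2 ^ k * m > 0" using Suc.prems by (cases m) auto
  ultimately show ?case
    using turn_double[of "2 ^ k * m"] by (simp add: mult.assoc)
qed

definition levelled_fold :: "'a \<Rightarrow> 'a \<Rightarrow> 'a \<Rightarrow> 'a word"
  where "levelled_fold a b c n =
    (if odd n then if turn n then a else b
     else if n mod 4 = 2 then if turn n then b else c
     else if turn n then a else c)"

lemma range_levelled_fold: "range (levelled_fold a b c) \<subseteq> {a, b, c}"
  by (auto simp: levelled_fold_def)

lemma levelled_fold_odd:
  "odd n \<Longrightarrow> levelled_fold a b c n = (if n mod 4 = 1 then a else b)"
  by (simp add: levelled_fold_def turn_odd)

lemma levelled_fold_level_one:
  assumes "n mod 4 = 2"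
  shows "levelled_fold a b c n = (if n mod 8 = 2 then b else c)"
proof -
  define m where "m = n div 2"
  have n: "n = 2 * m" and "odd m" using assms unfolding m_def by presburger+
  have "turn n \<longleftrightarrow> m mod 4 = 1"
    using turn_power_mult[OF \<open>odd m\<close>, of 1] by (simp add: n)
  moreover have "n mod 8 = 2 * (m mod 4)" using mult_mod_right[of 2 m 4] by (simp add: n)
  ultimately have "turn n \<longleftrightarrow> n mod 8 = 2" by auto
  moreover have "even n" by (simp add: n)
  ultimately show ?thesis using assms by (simp only: levelled_fold_def) simp
qed

lemma levelled_fold_high_level:
  "n mod 4 = 0 \<Longrightarrow> levelled_fold a b c n \<in> {a, c}"
  by (auto simp: levelled_fold_def mod_eq_0_iff_dvd)

lemma levelled_fold_power_mult:
  assumes "odd m"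
  shows "levelled_fold a b c (2 ^ k * m) =
    (if k = 0 then if m mod 4 = 1 then a else b
     else if k = 1 then if m mod 4 = 1 then b else c
     else if m mod 4 = 1 then a else c)"
proof -
  consider "k = 0" | "k = 1" | l where "k = Suc (Suc l)"
    by (metis One_nat_def not0_implies_Suc)
  then show ?thesis
  proof cases
    case 1
    then show ?thesis using assms by (simp add: levelled_fold_odd)
  next
    case 2
    moreover have "(2 * m) mod 4 = 2" "even (2 * m)" using assms by presburger+
    ultimately show ?thesis using turn_power_mult[OF assms, of 1]
      by (simp add: levelled_fold_def)
  next
    case 3
    then have "even (2 ^ k * m)" "(2 ^ k * m) mod 4 = 0" by simp_all
    then show ?thesis using 3 turn_power_mult[OF assms, of k]
      by (simp only: levelled_fold_def) simp
  qed
qed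

lemma add_odd_multiple_mod:
  fixes d n :: nat
  assumes "odd d"
  shows "odd n \<Longrightarrow> (n + 2 * d) mod 4 = 1 \<longleftrightarrow> n mod 4 \<noteq> 1"
    and "even n \<Longrightarrow> n mod 4 = 2 \<and> (n + 2 * d) mod 4 = 0 \<or> n mod 4 = 0 \<and> (n + 2 * d) mod 4 = 2"
    and "n mod 4 = 2 \<Longrightarrow> (n + 4 * d) mod 8 = 2 \<longleftrightarrow> n mod 8 \<noteq> 2"
proof -
  obtain l where "d = 2 * l + 1" using assms by (elim oddE)
  then have "n + 2 * d = n + 2 + l * 4" "n + 4 * d = n + 4 + l * 8" by simp_all
  then have mod: "(n + 2 * d) mod 4 = (n + 2) mod 4" "(n + 4 * d) mod 8 = (n + 4) mod 8"
    by (simp_all only: mod_mult_self1)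
  show "(n + 2 * d) mod 4 = 1 \<longleftrightarrow> n mod 4 \<noteq> 1" if "odd n"
    unfolding mod using that by presburger
  show "n mod 4 = 2 \<and> (n + 2 * d) mod 4 = 0 \<or> n mod 4 = 0 \<and> (n + 2 * d) mod 4 = 2" if "even n"
    unfolding mod using that by presburger
  show "(n + 4 * d) mod 8 = 2 \<longleftrightarrow> n mod 8 \<noteq> 2" if "n mod 4 = 2"
    unfolding mod using that by presburger
qed

text \<open>Adding twice an odd number to the odd part exchanges the residues 1 and 3 modulo 4, hence
  the two letters of the level.\<close>

lemma levelled_fold_flip:
  assumes "distinct [a, b, c]" "odd m" "odd d"
  shows "levelled_fold a b c (2 ^ k * m) \<noteq> levelled_fold a b c (2 ^ k * (m + 2 * d))"
proof -
  have "odd (m + 2 * d)" using assms by simp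
  moreover have "(m + 2 * d) mod 4 = 1 \<longleftrightarrow> m mod 4 \<noteq> 1"
    using add_odd_multiple_mod(1)[OF \<open>odd d\<close> \<open>odd m\<close>] .
  ultimately show ?thesis using assms(1,2) by (auto simp: levelled_fold_power_mult)
qed

section \<open>Squares in progressions of odd difference\<close>

lemma progression_hits_residue:
  fixes i j r M :: nat
  assumes "coprime j M" "M > 0"
  shows "\<exists>t<M. (i + t * j) mod M = r mod M"
proof -
  from cong_solve_coprime_nat[OF assms(1)] obtain x where "[j * x = Suc 0] (mod M)" ..
  then have x: "[j * x = 1] (mod M)" by simp
  \<comment> \<open>\<open>(M - 1) * i\<close> stands for \<open>- i\<close>, so \<open>y\<close> is the distance from \<open>i\<close> to \<open>r\<close>.\<close>
  define y where "y = r + (M - 1) * i"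
  define t where "t = (x * y) mod M"
  have "[t = x * y] (mod M)" by (simp add: t_def cong_def)
  then have "[i + t * j = i + (x * y) * j] (mod M)"
    by (intro cong_add cong_mult cong_refl)
  also have "i + (x * y) * j = i + (j * x) * y" by (simp only: ac_simps)
  also have "[i + (j * x) * y = i + 1 * y] (mod M)"
    by (intro cong_add cong_mult x cong_refl)
  also have "i + 1 * y = r + M * i"
    using \<open>M > 0\<close> by (cases M) (simp_all add: y_def)
  also have "[r + M * i = r] (mod M)" by (simp add: cong_def)
  finally have "(i + t * j) mod M = r mod M" by (simp only: cong_def)
  moreover have "t < M" using \<open>M > 0\<close> by (simp add: t_def)
  ultimately show ?thesis by blast
qed

text \<open>The oddness of the difference enters mainly here: \<open>j\<close> is coprime to every power of 2, so it
  only permutes the residues that decide the letters.\<close>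

lemma odd_progression_hits_residue:
  fixes i j r s :: nat
  assumes "odd j"
  shows "\<exists>t<2 ^ s. (i + t * j) mod 2 ^ s = r mod 2 ^ s"
proof (rule progression_hits_residue)
  show "coprime j (2 ^ s)" using assms by simp
qed simp

lemma no_square_of_even_period:
  assumes abc: "distinct [a, b, c]" and "odd j" "even p" "p > 0"
  shows "\<exists>t<p. levelled_fold a b c (i + t * j) \<noteq> levelled_fold a b c (i + (t + p) * j)"
proof -
  obtain d where d: "p = 2 ^ multiplicity 2 p * d" "odd d"
    using multiplicity_decompose'[of p 2] \<open>p > 0\<close> by auto
  have "multiplicity 2 p \<noteq> 0" using d \<open>even p\<close> by (metis mult_1 power_0)
  then obtain k where k: "p = 2 ^ Suc k * d"
    using d(1) by (metis not0_implies_Suc)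
  have "d > 0" using d(2) by (cases d) auto
  obtain t where t: "t < 2 ^ Suc k" "(i + t * j) mod 2 ^ Suc k = 2 ^ k mod 2 ^ Suc k"
    using odd_progression_hits_residue[OF \<open>odd j\<close>] by blast
  have "(2::nat) ^ Suc k \<le> p" using k \<open>d > 0\<close> by simp
  then have "t < p" using t(1) by simp
  define l where "l = (i + t * j) div 2 ^ Suc k"
  have "i + t * j = 2 ^ Suc k * l + 2 ^ k"
    using t(2) mult_div_mod_eq[of "2 ^ Suc k" "i + t * j"] by (simp add: l_def)
  then have pos: "i + t * j = 2 ^ k * (2 * l + 1)" by (simp add: algebra_simps)
  have "i + (t + p) * j = (i + t * j) + p * j" by (simp add: algebra_simps)
  also have "\<dots> = 2 ^ k * ((2 * l + 1) + 2 * (d * j))"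
    unfolding pos by (simp add: k algebra_simps)
  finally have "i + (t + p) * j = 2 ^ k * ((2 * l + 1) + 2 * (d * j))" .
  moreover have "odd (d * j)" using d(2) \<open>odd j\<close> by simp
  ultimately show ?thesis
    using levelled_fold_flip[OF abc, of "2 * l + 1" "d * j" k] pos \<open>t < p\<close>
    by (intro exI[of _ t]) simp
qed

lemma no_square_of_large_odd_period:
  assumes abc: "distinct [a, b, c]" and "odd j" "odd p" "p \<ge> 5"
  shows "\<exists>t<p. levelled_fold a b c (i + t * j) \<noteq> levelled_fold a b c (i + (t + p) * j)"
proof (rule ccontr)
  let ?w = "levelled_fold a b c"
  assume "\<not> ?thesis"
  then have square: "?w (i + t * j) = ?w (i + (t + p) * j)" if "t < p" for t
    using that by blast
  \<comment> \<open>The letter at residue 6 modulo 8 is \<open>c\<close>, and the square has at least 8 terms.\<close>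
  have "\<exists>t<8. (i + t * j) mod 8 = 6"
    using odd_progression_hits_residue[OF \<open>odd j\<close>, of 3 i 6] by simp
  then obtain t where t: "t < 8" "(i + t * j) mod 8 = 6" by blast
  have "(i + t * j) mod 4 = 2" using t(2) mod_mod_cancel[of 4 8 "i + t * j"] by simp
  then have c: "?w (i + t * j) = c"
    using t(2) by (simp add: levelled_fold_level_one)
  have "even (i + t * j)"
    using t(2) mod_mod_cancel[of 2 8 "i + t * j"] by (simp add: even_iff_mod_2_eq_zero)
  define u where "u = (if t < p then t + p else t - p)"
  have "?w (i + t * j) = ?w (i + u * j)"
    using square[of t] square[of "t - p"] t(1) \<open>p \<ge> 5\<close> by (auto simp: u_def)
  moreover have "odd (i + u * j)"
    using \<open>even (i + t * j)\<close> \<open>odd j\<close> \<open>odd p\<close> by (auto simp: u_def)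
  ultimately show False using c abc by (auto simp: levelled_fold_odd split: if_splits)
qed

text \<open>A square of period 3 has three consecutive even positions \<open>q\<close>, \<open>q + 2 * j\<close>, \<open>q + 4 * j\<close>, and
  the outer two are matched with odd positions. If the outer two have level 1, they carry different
  letters, so one carries \<open>c\<close>. Otherwise both carry \<open>a\<close>, the only letter that their pair shares with
  level 0, and then so do \<open>q + j\<close> and \<open>q + 3 * j\<close>; but those carry different letters.\<close>

lemma no_square_of_period_three:
  assumes abc: "distinct [a, b, c]" and "odd j"
  shows "\<exists>t<3. levelled_fold a b c (i + t * j) \<noteq> levelled_fold a b c (i + (t + 3) * j)"
proof (rule ccontr)
  let ?w = "levelled_fold a b c"
  assume "\<not> ?thesis"
  then have square: "?w (i + t * j) = ?w (i + (t + 3) * j)" if "t < 3" for t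
    using that by blast
  define q where "q = (if even i then i else i + j)"
  have "even q" using \<open>odd j\<close> by (simp add: q_def)
  have eq1: "?w q = ?w (q + 3 * j)"
    using square[of 0] square[of 1] by (auto simp: q_def algebra_simps)
  have eq2: "?w (q + j) = ?w (q + 4 * j)"
  proof (cases "even i")
    case True
    then show ?thesis using square[of 1] by (simp add: q_def)
  next
    case False
    have "i + j + j = i + 2 * j" "i + j + 4 * j = i + (2 + 3) * j" by simp_all
    then show ?thesis using False square[of 2] by (simp only: q_def if_False)
  qed
  have odd: "odd (q + j)" "odd (q + 3 * j)" using \<open>even q\<close> \<open>odd j\<close> by simp_all
  have "q + 3 * j = (q + j) + 2 * j" by simp
  then have flip: "(q + 3 * j) mod 4 = 1 \<longleftrightarrow> (q + j) mod 4 \<noteq> 1"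
    by (simp only: add_odd_multiple_mod(1)[OF \<open>odd j\<close> odd(1)])
  show False
  proof (cases "q mod 4 = 2")
    case True
    have "(q + 4 * j) mod 4 = 2" using True by simp
    moreover have "(q + 4 * j) mod 8 = 2 \<longleftrightarrow> q mod 8 \<noteq> 2"
      using add_odd_multiple_mod(3)[OF \<open>odd j\<close> True] .
    ultimately have "?w q = c \<or> ?w (q + 4 * j) = c"
      using True by (simp add: levelled_fold_level_one)
    then show False
      using eq1 eq2 odd abc by (auto simp: levelled_fold_odd split: if_splits)
  next
    case False
    then have "q mod 4 = 0" using \<open>even q\<close> by presburger
    then have "q mod 4 = 0" "(q + 4 * j) mod 4 = 0" by simp_all
    then have "?w q \<in> {a, c}" "?w (q + 4 * j) \<in> {a, c}"
      by (simp_all only: levelled_fold_high_level)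
    then show False
      using eq1 eq2 odd flip abc by (auto simp: levelled_fold_odd split: if_splits)
  qed
qed

lemma no_square_of_long_period:
  assumes "distinct [a, b, c]" "odd j" "p \<ge> 2"
  shows "\<exists>t<p. levelled_fold a b c (i + t * j) \<noteq> levelled_fold a b c (i + (t + p) * j)"
proof -
  have "even p \<or> p = 3 \<or> odd p \<and> p \<ge> 5" using \<open>p \<ge> 2\<close> by presburger
  then consider "even p" | "p = 3" | "odd p" "p \<ge> 5" by blast
  then show ?thesis
  proof cases
    case 1
    then show ?thesis using assms by (intro no_square_of_even_period) simp_all
  next
    case 2
    then show ?thesis using no_square_of_period_three[OF assms(1,2)] by blast
  next
    case 3
    then show ?thesis using assms by (intro no_square_of_large_odd_period)
  qed
qed

text \<open>Of three consecutive terms, either the outer two are at odd positions and differ, or they have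
  level 1 and a higher level and so agree only in \<open>c\<close>, while the middle one has level 0.\<close>

lemma no_cube_of_letter:
  assumes abc: "distinct [a, b, c]" and "odd j"
    and eq: "levelled_fold a b c i = levelled_fold a b c (i + j)"
      "levelled_fold a b c i = levelled_fold a b c (i + 2 * j)"
  shows False
proof (cases "even i")
  case False
  moreover have "odd (i + 2 * j)" using False by simp
  moreover have "(i + 2 * j) mod 4 = 1 \<longleftrightarrow> i mod 4 \<noteq> 1"
    using add_odd_multiple_mod(1)[OF \<open>odd j\<close> False] .
  ultimately show False using eq(2) abc by (auto simp: levelled_fold_odd split: if_splits)
next
  case True
  have "odd (i + j)" using True \<open>odd j\<close> by simp
  then have "levelled_fold a b c (i + j) \<noteq> c"
    using abc by (auto simp: levelled_fold_odd)
  moreover have "i mod 4 = 2 \<and> (i + 2 * j) mod 4 = 0 \<or> i mod 4 = 0 \<and> (i + 2 * j) mod 4 = 2"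
    using add_odd_multiple_mod(2)[OF \<open>odd j\<close> True] .
  ultimately show False
    using eq abc levelled_fold_high_level[of i a b c] levelled_fold_high_level[of "i + 2 * j" a b c]
    by (auto simp: levelled_fold_level_one split: if_splits)
qed

section \<open>Blocks of arithmetic subsequences\<close>

lemma contains_block_iff_nth:
  "contains_block v u \<longleftrightarrow> (\<exists>m. \<forall>t<length u. u ! t = v (m + t))"
proof
  assume "contains_block v u"
  then obtain m n where "u = map v [m..<n]"
    by (auto simp: contains_block_def subsequence_def)
  then show "\<exists>m. \<forall>t<length u. u ! t = v (m + t)" by auto
next
  assume "\<exists>m. \<forall>t<length u. u ! t = v (m + t)"
  then obtain m where "\<forall>t<length u. u ! t = v (m + t)" by blast
  then have "u = map v [m..<m + length u]" by (auto intro: nth_equalityI)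
  then show "contains_block v u" by (auto simp: contains_block_def subsequence_def)
qed

lemma contains_block_append_left:
  assumes "contains_block v (u @ u')"
  shows "contains_block v u"
proof -
  obtain m where m: "\<forall>t<length (u @ u'). (u @ u') ! t = v (m + t)"
    using assms unfolding contains_block_iff_nth by blast
  have "u ! t = v (m + t)" if "t < length u" for t
    using m[rule_format, of t] that by (simp add: nth_append)
  then show ?thesis unfolding contains_block_iff_nth by blast
qed

text \<open>Squares of single letters do occur, so for a root of length 1 the square alone gives no
  contradiction; the exponent above 2 then supplies a third copy of the letter.\<close>

lemma overlap_begins_with_square_or_cube:
  assumes "rat_power q u" "q > 2"
  obtains x z where "u = (x @ x) @ z" "length x \<ge> 2" | y z where "u = [y, y, y] @ z"
proof -
  obtain x k x' where u: "x \<noteq> []" "Sublist.prefix x' x" "u = concat (replicate k x) @ x'"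
    and q: "of_nat (length u) / of_nat (length x) = q"
    using assms(1) unfolding rat_power_def by blast
  have "(2::rat) * of_nat (length x) < of_nat (length u)"
    using assms(2) q u(1) by (auto simp: field_simps)
  then have "of_nat (2 * length x) < (of_nat (length u) :: rat)" by simp
  then have long: "2 * length x < length u" by (simp only: of_nat_less_iff)
  have "length x' \<le> length x" using u(2) by (rule prefix_length_le)
  moreover have "length u = k * length x + length x'"
    using u(3) by (simp add: length_concat sum_list_replicate)
  ultimately have "2 * length x < (k + 1) * length x"
    using long by (simp only: add_mult_distrib)
  then have "2 < k + 1" by (simp only: mult_less_cancel2)
  then have "k \<noteq> 0" "k \<noteq> 1" by simp_all
  then obtain l where l: "k = Suc (Suc l)" by (metis One_nat_def not0_implies_Suc)
  define z where "z = concat (replicate l x) @ x'"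
  have uz: "u = (x @ x) @ z" using u(3) by (simp add: l z_def)
  show thesis
  proof (cases "length x \<ge> 2")
    case True
    then show thesis using uz that(1) by blast
  next
    case False
    moreover have "length x > 0" using u(1) by simp
    ultimately have "length x = 1" by linarith
    then obtain y where y: "x = [y]" by (auto simp: length_Suc_conv)
    have "set z \<subseteq> set x" using set_mono_prefix[OF u(2)] by (auto simp: z_def)
    moreover have "z \<noteq> []" using long uz by auto
    ultimately obtain z' where "z = y # z'" using y by (cases z) auto
    then show thesis using uz y that(2)[of y z'] by simp
  qed
qed

lemma no_long_square_in_odd_subsequence:
  assumes "distinct [a, b, c]" "odd j" "arith_subsequence j v (levelled_fold a b c)"
    and "length x \<ge> 2"
  shows "\<not> contains_block v (x @ x)"
proof
  assume "contains_block v (x @ x)"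
  then obtain m where m: "\<And>t. t < length (x @ x) \<Longrightarrow> (x @ x) ! t = v (m + t)"
    unfolding contains_block_iff_nth by blast
  obtain i where v: "v = (\<lambda>n. levelled_fold a b c (i + n * j))"
    using assms(3) by (auto simp: arith_subsequence_def)
  have "levelled_fold a b c (i + m * j + t * j) =
      levelled_fold a b c (i + m * j + (t + length x) * j)" if "t < length x" for t
    using m[of t] m[of "t + length x"] that by (simp add: v nth_append algebra_simps)
  then show False using no_square_of_long_period[OF assms(1,2,4)] by blast
qed

lemma no_overlap_in_odd_subsequence:
  assumes "distinct [a, b, c]" "odd j" "arith_subsequence j v (levelled_fold a b c)"
  shows "\<not> contains_overlap v"
proof
  assume "contains_overlap v"
  then obtain q u where u: "rat_power q u" "q > 2" and block: "contains_block v u"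
    unfolding contains_overlap_def by blast
  from u show False
  proof (cases rule: overlap_begins_with_square_or_cube)
    case (1 x z)
    have "contains_block v (x @ x)"
      by (rule contains_block_append_left[OF block[unfolded 1(1)]])
    then show False
      using no_long_square_in_odd_subsequence[OF assms 1(2)] by simp
  next
    case (2 y z)
    have "contains_block v [y, y, y]"
      by (rule contains_block_append_left[OF block[unfolded 2]])
    then obtain m where m: "\<And>t. t < 3 \<Longrightarrow> [y, y, y] ! t = v (m + t)"
      unfolding contains_block_iff_nth by auto
    obtain i where v: "v = (\<lambda>n. levelled_fold a b c (i + n * j))"
      using assms(3) by (auto simp: arith_subsequence_def)
    have "v m = v (m + 1)" "v m = v (m + 2)" using m[of 0] m[of 1] m[of 2] by simp_all
    moreover have "i + (m + 1) * j = i + m * j + j" "i + (m + 2) * j = i + m * j + 2 * j"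
      by (simp_all add: add_mult_distrib)
    ultimately show False
      by (intro no_cube_of_letter[OF assms(1,2), of "i + m * j"]) (simp_all only: v)
  qed
qed

theorem theorem14:
  fixes A :: "'a set"
  assumes "card A = 3"
  shows "\<exists>w :: 'a word. range w \<subseteq> A \<and>
    (\<forall>j v. odd j \<and> arith_subsequence j v w \<longrightarrow> \<not> contains_overlap v) \<and>
    (\<forall>j v. odd j \<and> arith_subsequence j v w \<longrightarrow>
       \<not> (\<exists>x. length x \<ge> 2 \<and> contains_block v (x @ x)))"
proof -
  obtain a b c where A: "A = {a, b, c}" and abc: "distinct [a, b, c]"
    using assms by (auto simp: card_3_iff)
  show ?thesis
    using range_levelled_fold[of a b c] no_overlap_in_odd_subsequence[OF abc]
      no_long_square_in_odd_subsequence[OF abc] A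
    by (intro exI[of _ "levelled_fold a b c"]) blast
qed

end
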